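(* Let $N=\begin{pmatrix}1&1\\0&1\end{pmatrix}$. The five matrices $$A=\begin{pmatrix}0&0\\0&1\end{pmatrix},\quad B=\begin{pmatrix}0&0\\0&3\end{pmatrix},\quad C=\begin{pmatrix}0&2\\0&0\end{pmatrix},\quad D=\begin{pmatrix}1&2\\0&0\end{pmatrix},\quad E=\begin{pmatrix}3&2\\0&0\end{pmatrix}$$ form a Jordan $D(N)$-quintuple in $UT_2(\mathbb{Z})$. Moreover, this quintuple cannot be extended to a Jordan $D(N)$-sixtuple by any upper-triangular integer matrix; that is, there is no $F\in UT_2(\mathbb{Z})$ such that $\{A,B,C,D,E,F\}$ is a Jordan $D(N)$-$6$-tuple in $UT_2(\mathbb{Z})$.
   Context: $UT_2(\mathbb{Z})$ denotes the ring of upper-triangular $2\times 2$ integer matrices, and $A\circ B=\frac12(AB+BA)$ (computed over $\mathbb{Q}$) is the Jordan product. For $N\in UT_2(\mathbb{Z})$, a Jordan $D(N)$-$m$-tuple in $UT_2(\mathbb{Z})$ is a set of $m$ distinct nonzero matrices $A_1,\ldots,A_m\in UT_2(\mathbb{Z})$ such that for every $1\le i<j\le m$ there exists $X_{ij}\in UT_2(\mathbb{Z})$ with $A_i\circ A_j+N=X_{ij}^2$ (quintuple: $m=5$; sixtuple: $m=6$). *)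

theory Defs
  imports "Jordan_Normal_Form.Matrix"
begin

definition UT2 :: "int mat set" where
  "UT2 = {A \<in> carrier_mat 2 2. upper_triangular A}"

definition jordan_prod :: "rat mat \<Rightarrow> rat mat \<Rightarrow> rat mat" where
  "jordan_prod A B = (1 / 2) \<cdot>\<^sub>m (A * B + B * A)"

(* The entries of the Jordan product of two integer matrices may be half-integers, so
   the equation is stated over the rationals, while X ranges over integer matrices.
   The product is symmetric, so asking for all ordered pairs of distinct elements of
   the set S is the same as asking for all i < j in an enumeration of S. *)
definition jordan_D_tuple :: "int mat \<Rightarrow> nat \<Rightarrow> int mat set \<Rightarrow> bool" where
  "jordan_D_tuple N m S \<longleftrightarrow>
     finite S \<and> card S = m \<and> S \<subseteq> UT2 \<and> 0\<^sub>m 2 2 \<notin> S \<and>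
     (\<forall>P\<in>S. \<forall>Q\<in>S. P \<noteq> Q \<longrightarrow>
        (\<exists>X\<in>UT2. jordan_prod (map_mat rat_of_int P) (map_mat rat_of_int Q) + map_mat rat_of_int N
                  = map_mat rat_of_int (X ^\<^sub>m 2)))"

end

theory Submission
  imports Defs
begin

text \<open>
  Comparing entries, the condition on a pair of upper-triangular matrices becomes three integer
  equations: two that make the diagonal entries squares, \<open>x\<^sup>2\<close> and \<open>z\<^sup>2\<close>, and one for the corner,
  which must be a multiple \<open>y * (x + z)\<close> of the sum of the two square roots
  (\<open>jordan_square_iff\<close>). The five given matrices satisfy these equations with small witnesses; the
  pairs \<open>(A, B)\<close> and \<open>(D, E)\<close> force square roots of opposite sign.

  The extension fails for a reason of parity. Let \<open>F\<close> have diagonal \<open>a, c\<close>. The pairs with \<open>D\<close> and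
  \<open>E\<close> make \<open>a + 1\<close> and \<open>3 * a + 1\<close> squares, the pairs with \<open>A\<close> and \<open>B\<close> do the same for \<open>c\<close>, and
  this forces \<open>a\<close> and \<open>c\<close> to be even (\<open>even_if_squares\<close>). The pair with \<open>C\<close>, however, has
  diagonal \<open>1, 1\<close> and corner \<open>a + c + 1\<close>; the square roots are \<open>\<plusminus>1\<close>, their sum is even, and so
  \<open>a + c\<close> is odd.
\<close>

definition ut :: "int \<Rightarrow> int \<Rightarrow> int \<Rightarrow> int mat" where
  "ut a b c = mat_of_rows_list 2 [[a, b], [0, c]]"

lemma ut_carrier [simp]: "ut a b c \<in> carrier_mat 2 2"
  by (simp add: ut_def mat_of_rows_list_def numeral_2_eq_2)

lemma ut_dim [simp]: "dim_row (ut a b c) = 2" "dim_col (ut a b c) = 2"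
  using ut_carrier by (blast dest: carrier_matD)+

lemma ut_index [simp]:
  "ut a b c $$ (0, 0) = a" "ut a b c $$ (0, Suc 0) = b"
  "ut a b c $$ (Suc 0, 0) = 0" "ut a b c $$ (Suc 0, Suc 0) = c"
  by (simp_all add: ut_def mat_of_rows_list_def)

lemma mat2_eq_iff:
  assumes "P \<in> carrier_mat 2 2" "Q \<in> carrier_mat 2 2"
  shows "P = Q \<longleftrightarrow> P $$ (0, 0) = Q $$ (0, 0) \<and> P $$ (0, Suc 0) = Q $$ (0, Suc 0)
    \<and> P $$ (Suc 0, 0) = Q $$ (Suc 0, 0) \<and> P $$ (Suc 0, Suc 0) = Q $$ (Suc 0, Suc 0)"
  using assms by (auto simp: mat_eq_iff numeral_2_eq_2 less_Suc_eq)

lemma ut_eq_iff: "ut a b c = ut a' b' c' \<longleftrightarrow> a = a' \<and> b = b' \<and> c = c'"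
  by (simp add: mat2_eq_iff)

lemma ut_eq_zero_iff: "ut a b c = 0\<^sub>m 2 2 \<longleftrightarrow> a = 0 \<and> b = 0 \<and> c = 0"
  by (simp add: mat2_eq_iff)

lemma UT2_iff: "M \<in> UT2 \<longleftrightarrow> (\<exists>a b c. M = ut a b c)"
proof
  assume "M \<in> UT2"
  then have M: "M \<in> carrier_mat 2 2" and "upper_triangular M"
    by (auto simp: UT2_def)
  then have "M $$ (Suc 0, 0) = 0"
    by auto
  with M have "M = ut (M $$ (0, 0)) (M $$ (0, Suc 0)) (M $$ (Suc 0, Suc 0))"
    by (simp add: mat2_eq_iff)
  then show "\<exists>a b c. M = ut a b c" by blast
next
  assume "\<exists>a b c. M = ut a b c"
  then show "M \<in> UT2"
    by (auto simp: UT2_def upper_triangular_def numeral_2_eq_2 less_Suc_eq)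
qed

lemma mat2_mult_index:
  assumes "P \<in> carrier_mat 2 2" "Q \<in> carrier_mat 2 2" "i < 2" "j < 2"
  shows "(P * Q) $$ (i, j) = P $$ (i, 0) * Q $$ (0, j) + P $$ (i, Suc 0) * Q $$ (Suc 0, j)"
  using assms by (simp add: scalar_prod_def numeral_2_eq_2)

lemma ut_square: "ut x y z ^\<^sub>m 2 = ut (x\<^sup>2) (y * (x + z)) (z\<^sup>2)"
proof -
  have "ut x y z ^\<^sub>m 2 = ut x y z * ut x y z"
    by (simp add: numeral_2_eq_2 left_mult_one_mat[OF ut_carrier])
  also have "\<dots> = ut (x\<^sup>2) (y * (x + z)) (z\<^sup>2)"
    by (subst mat2_eq_iff)
      (simp_all add: mult_carrier_mat[of _ _ 2] mat2_mult_index del: index_mult_mat,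
       simp add: power2_eq_square algebra_simps)
  finally show ?thesis .
qed

definition jordan_square :: "int mat \<Rightarrow> int mat \<Rightarrow> int mat \<Rightarrow> bool" where
  "jordan_square N P Q \<longleftrightarrow>
     (\<exists>X\<in>UT2. jordan_prod (map_mat rat_of_int P) (map_mat rat_of_int Q) + map_mat rat_of_int N
                = map_mat rat_of_int (X ^\<^sub>m 2))"

lemma jordan_D_tupleD:
  assumes "jordan_D_tuple N m S" "P \<in> S" "Q \<in> S" "P \<noteq> Q"
  shows "jordan_square N P Q"
  using assms by (simp add: jordan_D_tuple_def jordan_square_def)

text \<open>
  The corner equation is doubled so that the half-integral corner of the Jordan product
  disappears and the criterion lives entirely over the integers.
\<close>

lemma jordan_square_iff:
  "jordan_square (ut n r m) (ut a b c) (ut a' b' c') \<longleftrightarrow>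
     (\<exists>x y z. a * a' + n = x\<^sup>2 \<and> c * c' + m = z\<^sup>2
        \<and> a * b' + b * c' + a' * b + b' * c + 2 * r = 2 * (y * (x + z)))"
proof -
  have entries: "jordan_prod (map_mat rat_of_int (ut a b c)) (map_mat rat_of_int (ut a' b' c'))
        + map_mat rat_of_int (ut n r m) = map_mat rat_of_int (ut s t u)
      \<longleftrightarrow> a * a' + n = s \<and> c * c' + m = u
        \<and> a * b' + b * c' + a' * b + b' * c + 2 * r = 2 * t" (is "?L \<longleftrightarrow> ?R") for s t u
  proof -
    have "?L \<longleftrightarrow> rat_of_int (a * a' + n) = rat_of_int s \<and> rat_of_int (c * c' + m) = rat_of_int u
        \<and> rat_of_int (a * b' + b * c' + a' * b + b' * c + 2 * r) = rat_of_int (2 * t)"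
      unfolding jordan_prod_def
      by (subst mat2_eq_iff)
        (auto simp: mult_carrier_mat[of _ _ 2] mat2_mult_index field_simps
          simp del: index_mult_mat(1))
    then show ?thesis
      by (simp only: of_int_eq_iff)
  qed
  have "jordan_square (ut n r m) (ut a b c) (ut a' b' c') \<longleftrightarrow>
      (\<exists>x y z. jordan_prod (map_mat rat_of_int (ut a b c)) (map_mat rat_of_int (ut a' b' c'))
        + map_mat rat_of_int (ut n r m)
        = map_mat rat_of_int (ut (x\<^sup>2) (y * (x + z)) (z\<^sup>2)))"
    unfolding jordan_square_def by (metis UT2_iff ut_square)
  then show ?thesis
    unfolding entries .
qed

lemma jordan_square_sym:
  "jordan_square (ut n r m) (ut a b c) (ut a' b' c') \<longleftrightarrow>
   jordan_square (ut n r m) (ut a' b' c') (ut a b c)"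
  unfolding jordan_square_iff by (simp add: algebra_simps)

lemma jordan_squareI:
  assumes "a * a' + n = x\<^sup>2" "c * c' + m = z\<^sup>2"
    and "a * b' + b * c' + a' * b + b' * c + 2 * r = 2 * (y * (x + z))"
  shows "jordan_square (ut n r m) (ut a b c) (ut a' b' c')"
  using assms unfolding jordan_square_iff by blast

text \<open>
  If \<open>a\<close> were odd, both square roots would be even, and then \<open>3 * s\<^sup>2 - t\<^sup>2 = 2\<close> would be
  divisible by 4.
\<close>

lemma even_if_squares:
  fixes a s t :: int
  assumes s: "a + 1 = s\<^sup>2" and t: "3 * a + 1 = t\<^sup>2"
  shows "even a"
proof (rule ccontr)
  assume "odd a"
  then have "even (s\<^sup>2)" "even (t\<^sup>2)"
    by (simp_all flip: s t)
  then obtain u v where "s = 2 * u" "t = 2 * v"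
    by (auto elim!: evenE)
  with s t have "2 = 4 * (3 * u\<^sup>2 - v\<^sup>2)"
    by (simp add: power_mult_distrib)
  then show False
    by presburger
qed

lemma card_insert_top_notin:
  assumes "card (insert x S) = Suc n" "card S = n" "finite S"
  shows "x \<notin> S"
  using assms by (auto simp: insert_absorb)

lemma jordan_quintuple:
  "jordan_D_tuple (ut 1 1 1) 5 {ut 0 0 1, ut 0 0 3, ut 0 2 0, ut 1 2 0, ut 3 2 0}"
proof -
  have AB: "jordan_square (ut 1 1 1) (ut 0 0 1) (ut 0 0 3)"
    by (rule jordan_squareI[where x = "-1" and y = 1 and z = 2]) simp_all
  have DE: "jordan_square (ut 1 1 1) (ut 1 2 0) (ut 3 2 0)"
    by (rule jordan_squareI[where x = 2 and y = 5 and z = "-1"]) simp_all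
  have "jordan_square (ut 1 1 1) (ut 0 0 1) (ut 0 2 0)"
       "jordan_square (ut 1 1 1) (ut 0 0 1) (ut 1 2 0)"
       "jordan_square (ut 1 1 1) (ut 0 0 1) (ut 3 2 0)"
       "jordan_square (ut 1 1 1) (ut 0 2 0) (ut 1 2 0)"
    by (rule jordan_squareI[where x = 1 and y = 1 and z = 1]; simp)+
  moreover have "jordan_square (ut 1 1 1) (ut 0 0 3) (ut 0 2 0)"
       "jordan_square (ut 1 1 1) (ut 0 0 3) (ut 1 2 0)"
       "jordan_square (ut 1 1 1) (ut 0 0 3) (ut 3 2 0)"
       "jordan_square (ut 1 1 1) (ut 0 2 0) (ut 3 2 0)"
    by (rule jordan_squareI[where x = 1 and y = 2 and z = 1]; simp)+
  moreover note AB DE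
  ultimately show ?thesis
    unfolding jordan_D_tuple_def jordan_square_def[symmetric]
    using jordan_square_sym
    by (auto simp: ut_eq_iff ut_eq_zero_iff UT2_iff eq_commute[of "0\<^sub>m 2 2"])
qed

theorem proposition11:
  fixes N A B C D E :: "int mat"
  assumes "N = mat_of_rows_list 2 [[1, 1], [0, 1]]"
    and "A = mat_of_rows_list 2 [[0, 0], [0, 1]]"
    and "B = mat_of_rows_list 2 [[0, 0], [0, 3]]"
    and "C = mat_of_rows_list 2 [[0, 2], [0, 0]]"
    and "D = mat_of_rows_list 2 [[1, 2], [0, 0]]"
    and "E = mat_of_rows_list 2 [[3, 2], [0, 0]]"
  shows "jordan_D_tuple N 5 {A, B, C, D, E} \<and>
         \<not> (\<exists>F\<in>UT2. jordan_D_tuple N 6 {A, B, C, D, E, F})"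
proof -
  have ut: "N = ut 1 1 1" "A = ut 0 0 1" "B = ut 0 0 3" "C = ut 0 2 0" "D = ut 1 2 0" "E = ut 3 2 0"
    using assms by (simp_all add: ut_def)
  have quintuple: "jordan_D_tuple N 5 {A, B, C, D, E}"
    using jordan_quintuple by (simp only: ut)
  moreover have False if "F \<in> UT2" and six: "jordan_D_tuple N 6 {A, B, C, D, E, F}" for F
  proof -
    obtain a b c where F: "F = ut a b c"
      using \<open>F \<in> UT2\<close> by (auto simp: UT2_iff)
    have "{A, B, C, D, E, F} = insert F {A, B, C, D, E}"
      by blast
    with six quintuple have "F \<notin> {A, B, C, D, E}"
      by (intro card_insert_top_notin[where n = 5]) (simp_all add: jordan_D_tuple_def)
    then have sq: "jordan_square N P F" if "P \<in> {A, B, C, D, E}" for P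
      using jordan_D_tupleD[OF six, of P F] that by auto
    obtain s t where "a + 1 = s\<^sup>2" "3 * a + 1 = t\<^sup>2"
      using sq[of D] sq[of E] by (auto simp: ut F jordan_square_iff)
    then have "even a"
      by (rule even_if_squares)
    obtain s t where "c + 1 = s\<^sup>2" "3 * c + 1 = t\<^sup>2"
      using sq[of A] sq[of B] by (auto simp: ut F jordan_square_iff)
    then have "even c"
      by (rule even_if_squares)
    obtain x y z where "1 = x\<^sup>2" "1 = z\<^sup>2" "2 * c + a * 2 + 2 = 2 * (y * (x + z))"
      using sq[of C] by (auto simp: ut F jordan_square_iff)
    then have "odd x" "odd z" and corner: "a + c + 1 = y * (x + z)"
      by (auto simp: eq_commute[of 1] power2_eq_1_iff)
    then have "even (a + c + 1)"
      unfolding corner by simp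
    with \<open>even a\<close> \<open>even c\<close> show False
      by simp
  qed
  ultimately show ?thesis
    by blast
qed

end
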